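(* Let $P$ be a $\sigma$-program. The relation $<_P^{\mathrm{fin}}$ on $\mathrm{Lab}_P^{\mathrm{fin}}$ is irreflexive and a strict order. For $B',B''\in\mathrm{Lab}_P^{\mathrm{fin}}$, the relationships $B'\not<_P^{\mathrm{fin}}B''$ and $B''\not<_P^{\mathrm{fin}}B'$ together mean $B'=B''$. The relation $\le_P^{\mathrm{fin}}$ is a reflexive, transitive, antisymmetric, and linear order. Moreover, any nonempty subset of $\mathrm{Lab}_P^{\mathrm{fin}}$ has a minimal element with respect to $\le_P^{\mathrm{fin}}$.
   Context: **Programs.** Let $\sigma=(n_1;m_1,\ldots,m_{n_2};k_1,\ldots,k_{n_3})$ be a finite signature with constant symbols $c_i^0$, operation symbols $f_i^{m_i}$, relation symbols $r_i^{k_i}$. A $\sigma$-program $P$ is a list $1:\mathrm{instruction}_1;\ \ldots;\ \ell_P-1:\mathrm{instruction}_{\ell_P-1};\ \ell_P:\text{stop}$ with $\ell_P\ge1$, where each instruction with label $\ell<\ell_P$ has one of the forms: (1) $Z_j:=f_i^{m_i}(Z_{j_1},\ldots,Z_{j_{m_i}})$; (2) $Z_j:=c_i^0$; (3) $Z_{I_j}:=Z_{I_k}$; (4) if $r_i^{k_i}(Z_{j_1},\ldots,Z_{j_{k_i}})$ then goto $\ell_1'$ else goto $\ell_2'$; (5) if $I_j=I_k$ then goto $\ell_1'$ else goto $\ell_2'$; (6) $I_j:=1$; (7) $I_j:=I_j+1$; (11) goto $\ell_1'$ or goto $\ell_2'$; with $\ell_1',\ell_2'\in L_P=\{1,\ldots,\ell_P\}$.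 Let $L_P^{\circ}=\{1,\ldots,\ell_P-1\}$, $L_P^{\mathrm B}$ = labels of types (4),(5),(11), $L_P^{\mathrm{NB}}=L_P^\circ\setminus L_P^{\mathrm B}$. Put $\beta_P(\ell)=\ell+1$ for $\ell\in L_P^{\mathrm{NB}}$ and, for $\ell\in L_P^{\mathrm B}$, $\beta_P^+(\ell)=\ell_1'$, $\beta_P^-(\ell)=\ell_2'$. **Finite $P$-paths.** A finite $P$-path of length $s\ge1$ is $(\ell_1,\ldots,\ell_s)\in L_P^s$ with $\ell_1=1$, $\ell_s=\ell_P$, $\ell_t\in L_P^\circ$ for $t<s$, and for all $t<s$: $\ell_{t+1}=\beta_P(\ell_t)$ if $\ell_t\in L_P^{\mathrm{NB}}$, $\ell_{t+1}\in\{\beta_P^+(\ell_t),\beta_P^-(\ell_t)\}$ if $\ell_t\in L_P^{\mathrm B}$. $\mathrm{Lab}_P^{\mathrm{fin}}$ is the set of all finite $P$-paths. **The order.** For $B^{(1)}=(\ell_{1,1},\ldots,\ell_{1,s_1})$ and $B^{(2)}=(\ell_{2,1},\ldots,\ell_{2,s_2})$ in $\mathrm{Lab}_P^{\mathrm{fin}}$, $B^{(1)}<_P^{\mathrm{fin}}B^{(2)}$ holds iff either $s_1<s_2$, or $s_1=s_2\ge3$ and there is $j\in\{2,\ldots,s_1-1\}$ with $\ell_{1,i}=\ell_{2,i}$ for all $i\in\{1,\ldots,j-1\}$ and $\ell_{1,j}<\ell_{2,j}$ (usual order on integers). $B^{(1)}\le_P^{\mathrm{fin}}B^{(2)}$ means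 $B^{(1)}<_P^{\mathrm{fin}}B^{(2)}$ or $B^{(1)}=B^{(2)}$. *)

theory Defs
  imports Main
begin

text \<open>
  A signature \<open>(n\<^sub>1; m\<^sub>1, \<dots>; k\<^sub>1, \<dots>)\<close>: the number of constant symbols and the lists of arities of the
  operation symbols and of the relation symbols.  Symbols, registers, labels and positions
  in a path are all numbered from 1, while lists are indexed from 0.
\<close>

record signature =
  num_consts :: nat
  op_arities :: "nat list"
  rel_arities :: "nat list"

type_synonym label = nat

datatype instruction =
    Op_Assign nat nat "nat list"                  \<comment> \<open>\<open>j i js\<close>: \<open>Z\<^sub>j := f\<^sub>i(Z\<^sub>j\<^sub>s)\<close>\<close>
  | Const_Assign nat nat                          \<comment> \<open>\<open>j i\<close>: \<open>Z\<^sub>j := c\<^sub>i\<close>\<close>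
  | Copy nat nat                                  \<comment> \<open>\<open>j k\<close>: \<open>Z\<close> at address \<open>I\<^sub>j := Z\<close> at address \<open>I\<^sub>k\<close>\<close>
  | Rel_Branch nat "nat list" label label         \<comment> \<open>\<open>i js l\<^sub>1 l\<^sub>2\<close>: if \<open>r\<^sub>i(Z\<^sub>j\<^sub>s)\<close> then goto \<open>l\<^sub>1\<close> else goto \<open>l\<^sub>2\<close>\<close>
  | Index_Branch nat nat label label              \<comment> \<open>\<open>j k l\<^sub>1 l\<^sub>2\<close>: if \<open>I\<^sub>j = I\<^sub>k\<close> then goto \<open>l\<^sub>1\<close> else goto \<open>l\<^sub>2\<close>\<close>
  | Index_One nat                                 \<comment> \<open>\<open>j\<close>: \<open>I\<^sub>j := 1\<close>\<close>
  | Index_Suc nat                                 \<comment> \<open>\<open>j\<close>: \<open>I\<^sub>j := I\<^sub>j + 1\<close>\<close>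
  | Choice label label                            \<comment> \<open>\<open>l\<^sub>1 l\<^sub>2\<close>: goto \<open>l\<^sub>1\<close> or goto \<open>l\<^sub>2\<close>\<close>
  | Stop

type_synonym program = "instruction list"

abbreviation nth1 :: "'a list \<Rightarrow> nat \<Rightarrow> 'a" where
  "nth1 xs i \<equiv> xs ! (i - 1)"

definition labels :: "program \<Rightarrow> label set" where
  "labels P = {1..length P}"

definition inner_labels :: "program \<Rightarrow> label set" where
  "inner_labels P = {1..<length P}"

text \<open>
  Admissible instructions at the inner labels, for the label set \<open>L\<close>; \<open>Stop\<close> is not one of them.
\<close>

fun wf_instruction :: "signature \<Rightarrow> label set \<Rightarrow> instruction \<Rightarrow> bool" where
  "wf_instruction \<sigma> L (Op_Assign j i js) \<longleftrightarrow>
     j \<ge> 1 \<and> i \<in> {1..length (op_arities \<sigma>)} \<and>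
     length js = nth1 (op_arities \<sigma>) i \<and> (\<forall>k\<in>set js. k \<ge> 1)"
| "wf_instruction \<sigma> L (Const_Assign j i) \<longleftrightarrow> j \<ge> 1 \<and> i \<in> {1..num_consts \<sigma>}"
| "wf_instruction \<sigma> L (Copy j k) \<longleftrightarrow> j \<ge> 1 \<and> k \<ge> 1"
| "wf_instruction \<sigma> L (Rel_Branch i js l1 l2) \<longleftrightarrow>
     i \<in> {1..length (rel_arities \<sigma>)} \<and>
     length js = nth1 (rel_arities \<sigma>) i \<and> (\<forall>k\<in>set js. k \<ge> 1) \<and> l1 \<in> L \<and> l2 \<in> L"
| "wf_instruction \<sigma> L (Index_Branch j k l1 l2) \<longleftrightarrow> j \<ge> 1 \<and> k \<ge> 1 \<and> l1 \<in> L \<and> l2 \<in> L"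
| "wf_instruction \<sigma> L (Index_One j) \<longleftrightarrow> j \<ge> 1"
| "wf_instruction \<sigma> L (Index_Suc j) \<longleftrightarrow> j \<ge> 1"
| "wf_instruction \<sigma> L (Choice l1 l2) \<longleftrightarrow> l1 \<in> L \<and> l2 \<in> L"
| "wf_instruction \<sigma> L Stop \<longleftrightarrow> False"

definition is_program :: "signature \<Rightarrow> program \<Rightarrow> bool" where
  "is_program \<sigma> P \<longleftrightarrow>
     length P \<ge> 1 \<and> nth1 P (length P) = Stop \<and>
     (\<forall>l\<in>inner_labels P. wf_instruction \<sigma> (labels P) (nth1 P l))"

fun is_branch :: "instruction \<Rightarrow> bool" where
  "is_branch (Rel_Branch i js l1 l2) \<longleftrightarrow> True"
| "is_branch (Index_Branch j k l1 l2) \<longleftrightarrow> True"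
| "is_branch (Choice l1 l2) \<longleftrightarrow> True"
| "is_branch _ \<longleftrightarrow> False"

definition branch_labels :: "program \<Rightarrow> label set" where
  "branch_labels P = {l \<in> inner_labels P. is_branch (nth1 P l)}"

definition nonbranch_labels :: "program \<Rightarrow> label set" where
  "nonbranch_labels P = inner_labels P - branch_labels P"

text \<open>
  The successor maps \<open>\<beta>\<^sub>P\<close>, \<open>\<beta>\<^sub>P\<^sup>+\<close>, \<open>\<beta>\<^sub>P\<^sup>-\<close> are partial: the first is only meant for labels in
  \<^term>\<open>nonbranch_labels P\<close>, the other two only for labels in \<^term>\<open>branch_labels P\<close>.
\<close>

definition beta :: "program \<Rightarrow> label \<Rightarrow> label" where
  "beta P l = l + 1"

definition beta_plus :: "program \<Rightarrow> label \<Rightarrow> label" where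
  "beta_plus P l =
     (case nth1 P l of
        Rel_Branch i js l1 l2 \<Rightarrow> l1
      | Index_Branch j k l1 l2 \<Rightarrow> l1
      | Choice l1 l2 \<Rightarrow> l1
      | _ \<Rightarrow> undefined)"

definition beta_minus :: "program \<Rightarrow> label \<Rightarrow> label" where
  "beta_minus P l =
     (case nth1 P l of
        Rel_Branch i js l1 l2 \<Rightarrow> l2
      | Index_Branch j k l1 l2 \<Rightarrow> l2
      | Choice l1 l2 \<Rightarrow> l2
      | _ \<Rightarrow> undefined)"

definition Lab_fin :: "program \<Rightarrow> label list set" where
  "Lab_fin P =
     {B. length B \<ge> 1 \<and> set B \<subseteq> labels P \<and>
         nth1 B 1 = 1 \<and> nth1 B (length B) = length P \<and>
         (\<forall>t\<in>{1..<length B}.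
            nth1 B t \<in> inner_labels P \<and>
            (nth1 B t \<in> nonbranch_labels P \<longrightarrow> nth1 B (t + 1) = beta P (nth1 B t)) \<and>
            (nth1 B t \<in> branch_labels P \<longrightarrow>
               nth1 B (t + 1) \<in> {beta_plus P (nth1 B t), beta_minus P (nth1 B t)}))}"

definition less_fin :: "program \<Rightarrow> label list rel" where
  "less_fin P =
     {(B1, B2). B1 \<in> Lab_fin P \<and> B2 \<in> Lab_fin P \<and>
        (length B1 < length B2 \<or>
         length B1 = length B2 \<and> length B1 \<ge> 3 \<and>
         (\<exists>j\<in>{2..length B1 - 1}.
            (\<forall>i\<in>{1..j - 1}. nth1 B1 i = nth1 B2 i) \<and> nth1 B1 j < nth1 B2 j))}"

definition le_fin :: "program \<Rightarrow> label list rel" where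
  "le_fin P =
     {(B1, B2). B1 \<in> Lab_fin P \<and> B2 \<in> Lab_fin P \<and> ((B1, B2) \<in> less_fin P \<or> B1 = B2)}"

end

theory Submission
  imports Defs
begin

text \<open>
  All paths share their first and their last label, so two paths of equal length can first
  differ only at a position in \<open>{2..s - 1}\<close>.  Hence the order is the restriction to paths of the
  length-lexicographic order on lists of naturals, which is a well-founded strict linear order.
\<close>

lemma less_fin_eq_lenlex:
  "less_fin P = lenlex less_than \<inter> Lab_fin P \<times> Lab_fin P"
proof -
  have "(B1, B2) \<in> less_fin P \<longleftrightarrow> (B1, B2) \<in> lenlex less_than"
    if B1: "B1 \<in> Lab_fin P" and B2: "B2 \<in> Lab_fin P" for B1 B2
  proof (cases "length B1 = length B2")
    case False
    with B1 B2 show ?thesis by (auto simp: less_fin_def lenlex_conv)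
  next
    case len: True
    have ends: "B1 ! 0 = B2 ! 0" "B1 ! (length B1 - 1) = B2 ! (length B1 - 1)"
      using B1 B2 len by (auto simp: Lab_fin_def)
    have "(B1, B2) \<in> less_fin P \<longleftrightarrow>
      length B1 \<ge> 3 \<and> (\<exists>j\<in>{2..length B1 - 1}.
        (\<forall>i\<in>{1..j - 1}. nth1 B1 i = nth1 B2 i) \<and> nth1 B1 j < nth1 B2 j)"
      using B1 B2 len by (simp add: less_fin_def)
    \<comment> \<open>The 1-based position \<open>j\<close> becomes the 0-based index
      \<open>i = j - 1\<close>, and agreement before it becomes equality of the prefixes
      \<open>take i\<close>, the form in which \<open>lexord_take_index_conv\<close> describes a
      first difference.\<close>
    also have "\<dots> \<longleftrightarrow> (\<exists>i<length B1. take i B1 = take i B2 \<and> B1 ! i < B2 ! i)"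
    proof (intro iffI; (elim conjE bexE exE)?)
      fix j
      assume j: "j \<in> {2..length B1 - 1}" and less: "nth1 B1 j < nth1 B2 j"
        and agree: "\<forall>i\<in>{1..j - 1}. nth1 B1 i = nth1 B2 i"
      have "B1 ! k = B2 ! k" if "k < j - 1" for k
        using agree[rule_format, of "Suc k"] that by simp
      then have "take (j - 1) B1 = take (j - 1) B2"
        using j len by (intro nth_equalityI) auto
      with j less show "\<exists>i<length B1. take i B1 = take i B2 \<and> B1 ! i < B2 ! i"
        by (intro exI[of _ "j - 1"]) auto
    next
      fix i
      assume i: "i < length B1" and agree: "take i B1 = take i B2" and less: "B1 ! i < B2 ! i"
      \<comment> \<open>A strict difference cannot sit at either end, by \<open>ends\<close>. So an
        index lies on each side of \<open>i\<close>, which yields both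
        \<open>length B1 \<ge> 3\<close> and the range of the witness
        \<open>j = Suc i\<close>.\<close>
      have "i \<noteq> 0" and "i \<noteq> length B1 - 1"
        using ends less by (auto intro: gr0I)
      with i have bounds: "1 \<le> i" "i < length B1 - 1"
        by auto
      have "nth1 B1 k = nth1 B2 k" if "k \<in> {1..i}" for k
        using that agree nth_take[of "k - 1" i B1] nth_take[of "k - 1" i B2] by auto
      with bounds less show "length B1 \<ge> 3 \<and> (\<exists>j\<in>{2..length B1 - 1}.
          (\<forall>i\<in>{1..j - 1}. nth1 B1 i = nth1 B2 i) \<and> nth1 B1 j < nth1 B2 j)"
        by (intro conjI bexI[of _ "Suc i"]) auto
    qed
    \<comment> \<open>For equal lengths \<open>lenlex\<close> reduces to \<open>lexord\<close>,
      whose alternative of a proper prefix cannot occur.\<close>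
    also have "\<dots> \<longleftrightarrow> (B1, B2) \<in> lenlex less_than"
      using len by (auto simp: lenlex_conv lexord_lex lexord_take_index_conv)
    finally show ?thesis .
  qed
  moreover have "less_fin P \<subseteq> Lab_fin P \<times> Lab_fin P"
    by (auto simp: less_fin_def)
  ultimately show ?thesis by auto
qed

text \<open>Since lengths are compared first, \<open>lenlex\<close> inherits well-foundedness from
  \<open><\<close> on labels, and a subrelation keeps it. Asymmetry and the existence of minimal
  elements both come from here.\<close>

lemma wf_less_fin: "wf (less_fin P)"
  unfolding less_fin_eq_lenlex by (rule wf_subset[OF wf_lenlex[OF wf_less_than]]) auto

lemma trans_less_fin: "trans (less_fin P)"
  unfolding less_fin_eq_lenlex
  by (intro trans_Int lenlex_transI) (auto simp: trans_def)

text \<open>\<open>lenlex\<close> of a total relation is total on all lists, and restriction to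
  paths keeps any two paths comparable. Trichotomy and linearity rest on this.\<close>

lemma total_on_less_fin: "total_on (Lab_fin P) (less_fin P)"
proof -
  have "total (lenlex less_than)"
    by (intro total_lenlex) (auto simp: total_on_def)
  then show ?thesis
    by (auto simp: total_on_def less_fin_eq_lenlex)
qed

theorem proposition4p14:
  fixes \<sigma> :: signature and P :: program
  assumes "is_program \<sigma> P"
  shows "irrefl (less_fin P) \<and> asym (less_fin P) \<and> trans (less_fin P) \<and>
    (\<forall>B'\<in>Lab_fin P. \<forall>B''\<in>Lab_fin P.
       (B', B'') \<notin> less_fin P \<longrightarrow> (B'', B') \<notin> less_fin P \<longrightarrow> B' = B'') \<and>
    refl_on (Lab_fin P) (le_fin P) \<and> trans (le_fin P) \<and> antisym (le_fin P) \<and>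
    linear_order_on (Lab_fin P) (le_fin P) \<and>
    (\<forall>S. S \<subseteq> Lab_fin P \<longrightarrow> S \<noteq> {} \<longrightarrow>
       (\<exists>B\<in>S. \<forall>B'\<in>S. (B', B) \<in> le_fin P \<longrightarrow> B' = B))"
proof -
  \<comment> \<open>A pair related in both directions would give an infinite descending
    chain.\<close>
  have asym: "asym (less_fin P)"
    by (rule wf_imp_asym[OF wf_less_fin])
  then have irrefl: "irrefl (less_fin P)"
    by (auto simp: irrefl_def dest: asymD)
  have tri: "\<forall>B'\<in>Lab_fin P. \<forall>B''\<in>Lab_fin P.
      (B', B'') \<notin> less_fin P \<longrightarrow> (B'', B') \<notin> less_fin P \<longrightarrow> B' = B''"
    using total_on_less_fin by (auto simp: total_on_def)
  have refl: "refl_on (Lab_fin P) (le_fin P)"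
    by (auto simp: refl_on_def le_fin_def)
  have trans: "trans (le_fin P)"
    using trans_less_fin by (auto simp: trans_def le_fin_def)
  have antisym: "antisym (le_fin P)"
    using asym by (auto simp: antisym_def le_fin_def dest: asymD)
  have "total_on (Lab_fin P) (le_fin P)"
    using tri by (auto simp: total_on_def le_fin_def)
  then have linear: "linear_order_on (Lab_fin P) (le_fin P)"
    using refl trans antisym
    by (auto simp: linear_order_on_def partial_order_on_def preorder_on_def le_fin_def)
  \<comment> \<open>A \<open>less_fin\<close>-minimal element of \<open>S\<close> serves: a member
    of \<open>S\<close> that is \<open>le_fin\<close>-below it cannot be strictly below, so it is
    equal.\<close>
  have "\<exists>B\<in>S. \<forall>B'\<in>S. (B', B) \<in> le_fin P \<longrightarrow> B' = B" if "S \<noteq> {}" for S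
    by (rule wfE_min'[OF wf_less_fin that]) (auto simp: le_fin_def)
  with asym irrefl tri refl trans antisym linear trans_less_fin show ?thesis
    by blast
qed

end
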